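(* Let $\Phi\in\{0,1\}^{n\times p}$ be the adjacency matrix of a $(2s,\varepsilon)$-unbalanced expander with expansion constant $\varepsilon\le 1/12$ and left degree $d$, and set $\mathbf X=\frac{1}{\sqrt d}\Phi$. If $1/\varepsilon$ and $d$ are smaller than $p$, then for all $c_0<4$, for all $S\subseteq\{1,\dots,p\}$ with $|S|\le s$, and for all $\gamma\in\mathbb R^p$, $\gamma\ne0$, such that $\|\gamma_{S^c}\|_1\le c_0\|\gamma_S\|_1$, it holds that $$\frac{\sqrt{|S|}\,\|\mathbf X\gamma\|_2}{\|\gamma_S\|_1}\ge\frac{4-c_0}{6}.$$ Hence the $(s,c_0)$-restricted $\ell_1$-eigenvalue satisfies $\phi(s,c_0)\ge\frac{4-c_0}{6}$.
   Context: Unbalanced expander: an $(s,\varepsilon)$-unbalanced expander is a bipartite simple graph $G=(A,B,E)$ with $|A|=p$ (left vertices), $|B|=n$ (right vertices), in which every vertex of $A$ has exactly $d$ neighbors in $B$ (left degree $d$), such that for every $S\subseteq A$ with $|S|\le s$ the set of neighbors $N(S)\subseteq B$ satisfies $|N(S)|\ge(1-\varepsilon)\,d\,|S|$. The parameter $\varepsilon>0$ is called the expansion constant. Its adjacency matrix $\Phi\in\{0,1\}^{n\times p}$ has $\Phi_{ij}=1$ if right vertex $i$ is connected to left vertex $j$, and $\Phi_{ij}=0$ otherwise. For a matrix $\mathbf X\in\mathbb R^{n\times p}$, the $(s,c_0)$-restricted $\ell_1$-eigenvalue (compatibility constant) is $$\phi(s,c_0):=\min_{\substack{S\subseteq\{1,\dots,p\}\\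 |S|\le s}}\ \min_{\substack{\gamma\ne0\\ \|\gamma_{S^c}\|_1\le c_0\|\gamma_S\|_1}}\frac{\sqrt{|S|}\,\|\mathbf X\gamma\|_2}{\|\gamma_S\|_1}.$$ Here $\gamma_S$ denotes the restriction of $\gamma$ to the coordinates in $S$ and $\gamma_{S^c}$ its restriction to the complement. *)

theory Defs
  imports "HOL-Analysis.Analysis" "HOL-Library.Extended_Real"
begin

text \<open>
  The left vertices are the elements of the finite type \<open>'p\<close>, the right vertices those of the
  finite type \<open>'n\<close>, so that \<open>p = CARD('p)\<close> and \<open>n = CARD('n)\<close>.  A bipartite simple graph
  is its set of edges \<open>E\<close>, a pair \<open>(j, i)\<close> standing for an edge between the left vertex \<open>j\<close>
  and the right vertex \<open>i\<close>.
\<close>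

definition neighbours :: "('p \<times> 'n) set \<Rightarrow> 'p set \<Rightarrow> 'n set" where
  "neighbours E S = {i. \<exists>j\<in>S. (j, i) \<in> E}"

definition unbalanced_expander ::
    "nat \<Rightarrow> real \<Rightarrow> nat \<Rightarrow> ('p::finite \<times> 'n::finite) set \<Rightarrow> bool" where
  "unbalanced_expander s \<epsilon> d E \<longleftrightarrow>
     \<epsilon> > 0 \<and>
     (\<forall>j. card (neighbours E {j}) = d) \<and>
     (\<forall>S. card S \<le> s \<longrightarrow> real (card (neighbours E S)) \<ge> (1 - \<epsilon>) * real d * real (card S))"

text \<open>Rows are indexed by the right vertices, columns by the left vertices.\<close>

definition adjacency_matrix :: "('p::finite \<times> 'n::finite) set \<Rightarrow> real ^ 'p ^ 'n" where
  "adjacency_matrix E = (\<chi> i j. if (j, i) \<in> E then 1 else 0)"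

definition l1_norm :: "real ^ 'p::finite \<Rightarrow> real" where
  "l1_norm x = (\<Sum>i\<in>UNIV. \<bar>x $ i\<bar>)"

definition restrict_vec :: "real ^ 'p::finite \<Rightarrow> 'p set \<Rightarrow> real ^ 'p" where
  "restrict_vec x S = (\<chi> i. if i \<in> S then x $ i else 0)"

text \<open>
  The minima are rendered as infima in the extended reals, so that a minimum over an empty set
  is \<open>\<infinity>\<close>.  This occurs for \<open>S = {}\<close>, and for every \<open>S\<close> if \<open>c0 < 0\<close>: no \<open>\<gamma> \<noteq> 0\<close>
  satisfies the constraint.  Otherwise the infimum is attained, since the quotient is continuous and
  invariant under scaling of \<open>\<gamma>\<close>, and the admissible \<open>\<gamma>\<close> with \<open>\<parallel>\<gamma>\<^sub>S\<parallel>\<^sub>1 = 1\<close> form a compact set.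
  The constraint and \<open>\<gamma> \<noteq> 0\<close> force the denominator to be nonzero.
\<close>

definition restricted_l1_eigenvalue ::
    "real ^ 'p::finite ^ 'n::finite \<Rightarrow> nat \<Rightarrow> real \<Rightarrow> ereal" where
  "restricted_l1_eigenvalue X s c0 =
     (INF S\<in>{S. card S \<le> s}.
        INF \<gamma>\<in>{\<gamma>. \<gamma> \<noteq> 0 \<and> l1_norm (restrict_vec \<gamma> (- S)) \<le> c0 * l1_norm (restrict_vec \<gamma> S)}.
          ereal (sqrt (real (card S)) * norm (X *v \<gamma>) / l1_norm (restrict_vec \<gamma> S)))"

end

theory Submission
  imports Defs
begin

text \<open>
  Replace \<open>S\<close> by a set \<open>T\<close> of \<open>|S|\<close> coordinates of maximal total mass.  Each right vertex \<open>i\<close> in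
  \<open>N(T)\<close> selects its heaviest neighbour \<open>f i\<close> in \<open>T\<close>, and the triangle inequality gives
  \<open>|(\<Phi> \<gamma>)\<^sub>i| \<ge> 2 |\<gamma>\<^bsub>f i\<^esub>| - (\<Sum>j\<in>N(i). |\<gamma>\<^sub>j|)\<close>.  Expansion of the superlevel sets of \<open>|\<gamma>|\<close> in \<open>T\<close> shows
  that most edges at \<open>T\<close> are selected, and expansion of \<open>T \<union> U\<close> for \<open>|U| \<le> |T|\<close> shows that few edges
  lead from the complement of \<open>T\<close> into \<open>N(T)\<close>.  Summing over \<open>N(T)\<close> and using Cauchy-Schwarz on this set
  of at most \<open>d |S|\<close> vertices gives the bound \<open>(1 - 4 \<epsilon> - 2 \<epsilon> c0) \<parallel>\<gamma>\<^sub>T\<parallel>\<^sub>1\<close>.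
\<close>

section \<open>Finite sums: levels and sets of maximal mass\<close>

text \<open>The discrete layer-cake principle, by peeling off the smallest positive level.\<close>

lemma sum_mult_nonneg_if_superlevel_sums_nonneg:
  fixes g x :: "'a \<Rightarrow> real"
  assumes "finite A" and "\<And>j. j \<in> A \<Longrightarrow> 0 \<le> x j"
    and "\<And>t. t > 0 \<Longrightarrow> 0 \<le> (\<Sum>j | j \<in> A \<and> t \<le> x j. g j)"
  shows "0 \<le> (\<Sum>j\<in>A. g j * x j)"
  using assms(2,3)
proof (induction "card {j \<in> A. 0 < x j}" arbitrary: x rule: less_induct)
  case less
  define P where "P = {j \<in> A. 0 < x j}"
  have "finite P" using assms(1) by (simp add: P_def)
  show ?case
  proof (cases "P = {}")
    case True
    then have "g j * x j = 0" if "j \<in> A" for j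
      using that less.prems(1)[OF that] by (force simp: P_def)
    then have "(\<Sum>j\<in>A. g j * x j) = 0" by (rule sum.neutral[OF ballI])
    then show ?thesis by simp
  next
    case False
    define m where "m = Min (x ` P)"
    have m_le: "m \<le> x j" if "j \<in> P" for j
      using that \<open>finite P\<close> by (simp add: m_def)
    have "m \<in> x ` P" unfolding m_def using \<open>finite P\<close> False by (intro Min_in) auto
    then obtain j0 where j0: "j0 \<in> P" "x j0 = m" by auto
    then have "m > 0" by (auto simp: P_def)
    \<comment> \<open>Every positive value drops by the least one, \<open>m\<close>, so
      \<open>j0\<close> leaves the support and the induction measure decreases. For
      \<open>t > 0\<close> the superlevel set of \<open>x'\<close> at \<open>t\<close> is that of
      \<open>x\<close> at \<open>t + m\<close>, hence the hypothesis on \<open>g\<close>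
      survives.\<close>
    define x' where "x' j = (if j \<in> P then x j - m else x j)" for j
    have x'0: "x' j = 0" if "j \<in> A" "j \<notin> P" for j
      using that less.prems(1)[OF that(1)] by (auto simp: x'_def P_def)
    have sub: "{j \<in> A. 0 < x' j} \<subseteq> P - {j0}"
    proof
      fix j assume "j \<in> {j \<in> A. 0 < x' j}"
      moreover have "x' j0 = 0" using j0 by (simp add: x'_def)
      ultimately show "j \<in> P - {j0}" using x'0[of j] by auto
    qed
    have "card {j \<in> A. 0 < x' j} < card P"
      using psubset_card_mono[of P "{j \<in> A. 0 < x' j}"] sub j0(1) \<open>finite P\<close> by blast
    moreover have "0 \<le> x' j" if "j \<in> A" for j
      using m_le that x'0[OF that] by (auto simp: x'_def)
    moreover have "0 \<le> (\<Sum>j | j \<in> A \<and> t \<le> x' j. g j)" if "t > 0" for t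
    proof -
      have "{j. j \<in> A \<and> t \<le> x' j} = {j. j \<in> A \<and> t + m \<le> x j}"
        using that \<open>m > 0\<close> x'0 by (force simp: x'_def P_def)
      then show ?thesis using less.prems(2)[of "t + m"] that \<open>m > 0\<close> by simp
    qed
    ultimately have IH: "0 \<le> (\<Sum>j\<in>A. g j * x' j)"
      using less.hyps[of x'] unfolding P_def by blast
    \<comment> \<open>The removed layer contributes \<open>m * sum g P\<close>, which is nonnegative
      because \<open>P\<close> is itself a superlevel set.\<close>
    have "{j. j \<in> A \<and> m \<le> x j} = P"
      using m_le \<open>m > 0\<close> by (force simp: P_def)
    then have "0 \<le> sum g P" using less.prems(2)[OF \<open>m > 0\<close>] by simp
    have "(\<Sum>j\<in>A. g j * x j) = (\<Sum>j\<in>A. g j * x' j + (if j \<in> P then m * g j else 0))"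
      by (intro sum.cong) (auto simp: x'_def algebra_simps)
    also have "\<dots> = (\<Sum>j\<in>A. g j * x' j) + (\<Sum>j\<in>A. if j \<in> P then m * g j else 0)"
      by (rule sum.distrib)
    also have "(\<Sum>j\<in>A. if j \<in> P then m * g j else 0) = m * sum g P"
      using assms(1) by (subst sum.inter_restrict[symmetric])
        (auto simp: P_def sum_distrib_left intro!: sum.cong)
    finally show ?thesis using IH \<open>0 \<le> sum g P\<close> \<open>m > 0\<close> by simp
  qed
qed

text \<open>Choose \<open>T\<close> with the greatest sum among the sets of this cardinality. If
  some \<open>i\<close> outside were heavier than some \<open>j\<close> inside, exchanging the two
  would increase the sum.\<close>

lemma obtain_max_sum_set:
  fixes x :: "'a::finite \<Rightarrow> real"
  obtains T where "card T = card S" "sum x S \<le> sum x T"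
    "\<And>i j. i \<notin> T \<Longrightarrow> j \<in> T \<Longrightarrow> x i \<le> x j"
proof -
  define F where "F = {T :: 'a set. card T = card S}"
  have F: "finite F" "S \<in> F" by (simp_all add: F_def)
  then have "Max (sum x ` F) \<in> sum x ` F" by (intro Max_in) auto
  then obtain T where T: "T \<in> F" "sum x T = Max (sum x ` F)" by auto
  then have max: "sum x T' \<le> sum x T" if "T' \<in> F" for T'
    using F that by simp
  show thesis
  proof
    show "card T = card S" using T(1) by (simp add: F_def)
    show "sum x S \<le> sum x T" using max F(2) .
    fix i j assume ij: "i \<notin> T" "j \<in> T"
    define T' where "T' = insert i (T - {j})"
    have "card T' = card T"
      using ij by (simp add: T'_def card.insert_remove card_gt_0_iff card_Diff_singleton)
        (metis Suc_pred card_gt_0_iff empty_iff finite)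
    then have "T' \<in> F" using T(1) by (simp add: F_def)
    moreover have "sum x T' = x i + (sum x T - x j)"
      using ij by (simp add: T'_def sum_diff1)
    ultimately show "x i \<le> x j" using max[of T'] by simp
  qed
qed

section \<open>Edge counts in an expander\<close>

lemma card_neighbours_le:
  fixes E :: "('p::finite \<times> 'n::finite) set"
  assumes "unbalanced_expander s \<epsilon> d E"
  shows "card (neighbours E S) \<le> d * card S"
proof -
  have "card (neighbours E S) = card (\<Union>j\<in>S. neighbours E {j})"
    by (rule arg_cong[of _ _ card]) (auto simp: neighbours_def)
  also have "\<dots> \<le> (\<Sum>j\<in>S. card (neighbours E {j}))" by (intro card_UN_le) simp
  also have "\<dots> = d * card S" using assms by (simp add: unbalanced_expander_def)
  finally show ?thesis .
qed

text \<open>There are \<open>d * (card T + card U)\<close> edges at \<open>T \<union> U\<close>, and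
  those from \<open>U\<close> into the neighbours of \<open>T\<close> reach no new vertex. Expansion
  lets at most the fraction \<open>\<epsilon>\<close> of all edges be wasted in this way.\<close>

lemma expander_common_neighbours_le:
  fixes E :: "('p::finite \<times> 'n::finite) set"
  assumes exp: "unbalanced_expander s \<epsilon> d E"
    and disj: "T \<inter> U = {}" and le: "card T + card U \<le> s"
  shows "(\<Sum>j\<in>U. real (card (neighbours E {j} \<inter> neighbours E T)))
           \<le> \<epsilon> * d * (card T + card U)"
proof -
  let ?N = "neighbours E"
  have deg: "card (?N {j}) = d" for j using exp by (simp add: unbalanced_expander_def)
  have "?N (T \<union> U) = ?N T \<union> (\<Union>j\<in>U. ?N {j} - ?N T)" by (auto simp: neighbours_def)
  then have "card (?N (T \<union> U)) \<le> card (?N T) + card (\<Union>j\<in>U. ?N {j} - ?N T)"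
    by (metis card_Un_le)
  also have "\<dots> \<le> d * card T + (\<Sum>j\<in>U. card (?N {j} - ?N T))"
    by (intro add_mono card_neighbours_le[OF exp] card_UN_le) simp
  finally have "real (card (?N (T \<union> U)))
      \<le> d * card T + (\<Sum>j\<in>U. real (card (?N {j} - ?N T)))"
    by (metis of_nat_add of_nat_mono of_nat_mult of_nat_sum)
  also have "(\<Sum>j\<in>U. real (card (?N {j} - ?N T)))
      = (\<Sum>j\<in>U. real d - real (card (?N {j} \<inter> ?N T)))"
  proof (intro sum.cong refl)
    fix j
    have "card (?N {j}) = card (?N {j} - ?N T) + card (?N {j} \<inter> ?N T)"
      by (subst card_Un_disjoint[symmetric]) (auto intro: arg_cong[of _ _ card])
    then show "real (card (?N {j} - ?N T)) = real d - real (card (?N {j} \<inter> ?N T))"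
      using deg[of j] by simp
  qed
  also have "\<dots> = d * card U - (\<Sum>j\<in>U. real (card (?N {j} \<inter> ?N T)))"
    by (simp add: sum_subtractf)
  finally have upper: "real (card (?N (T \<union> U)))
      \<le> d * card T + (d * card U - (\<Sum>j\<in>U. real (card (?N {j} \<inter> ?N T))))" by simp
  have cardTU: "card (T \<union> U) = card T + card U" using disj by (simp add: card_Un_disjoint)
  then have "real (card (?N (T \<union> U))) \<ge> (1 - \<epsilon>) * d * (card T + card U)"
    using exp le unfolding unbalanced_expander_def by (metis of_nat_add)
  with upper show ?thesis by (simp add: algebra_simps)
qed

text \<open>Splitting \<open>U\<close> into blocks of size at most \<open>|T|\<close> removes the bound on \<open>|U|\<close>.\<close>

lemma expander_common_neighbours_le_blocks:
  fixes E :: "('p::finite \<times> 'n::finite) set"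
  assumes exp: "unbalanced_expander (2 * s) \<epsilon> d E"
    and "T \<inter> U = {}" and T: "card T \<le> s" "T \<noteq> {}"
  shows "(\<Sum>j\<in>U. real (card (neighbours E {j} \<inter> neighbours E T)))
           \<le> 2 * \<epsilon> * d * (card T + card U)"
  using assms(2)
proof (induction "card U" arbitrary: U rule: less_induct)
  case less
  let ?e = "\<lambda>j. real (card (neighbours E {j} \<inter> neighbours E T))"
  have \<epsilon>: "\<epsilon> > 0" using exp by (simp add: unbalanced_expander_def)
  have small: "sum ?e V \<le> \<epsilon> * d * (card T + card V)"
    if "T \<inter> V = {}" "card V \<le> card T" for V
    using expander_common_neighbours_le[OF exp that(1)] that(2) T by simp
  show ?case
  proof (cases "card U \<le> card T")
    case True
    have "0 \<le> \<epsilon> * d * (card T + card U)" using \<epsilon> by simp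
    then show ?thesis using small[OF less.prems True] by simp
  next
    case False
    then obtain V where V: "V \<subseteq> U" "card V = card T"
      by (metis nat_le_linear obtain_subset_with_card_n)
    have "card T > 0" using T by (simp add: card_gt_0_iff)
    then have card: "card (U - V) = card U - card T" "card (U - V) < card U"
      using V False by (auto simp: card_Diff_subset)
    \<comment> \<open>The block \<open>V\<close> of size \<open>card T\<close> costs at most
      \<open>\<epsilon> * d * (2 * card T)\<close>, exactly the amount by which the claimed bound
      decreases from \<open>U\<close> to \<open>U - V\<close>. This is the source of the factor
      2.\<close>
    have "sum ?e U = sum ?e (U - V) + sum ?e V"
      using V by (intro sum.subset_diff) auto
    also have "\<dots> \<le> 2 * \<epsilon> * d * (card T + card (U - V)) + \<epsilon> * d * (card T + card V)"
      using less V card by (intro add_mono small less.hyps) auto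
    also have "\<dots> = 2 * \<epsilon> * d * (card T + card U)"
      using False V card by (simp add: of_nat_diff algebra_simps)
    finally show ?thesis .
  qed
qed

section \<open>The l1 mass on the neighbours of the heaviest coordinates\<close>

lemma adjacency_mult_nth:
  "(adjacency_matrix E *v \<gamma>) $ i = (\<Sum>j | (j, i) \<in> E. \<gamma> $ j)"
proof -
  have "(adjacency_matrix E *v \<gamma>) $ i = (\<Sum>j\<in>UNIV. if j \<in> {j. (j, i) \<in> E} then \<gamma> $ j else 0)"
    by (auto simp: adjacency_matrix_def matrix_vector_mult_def intro!: sum.cong)
  also have "\<dots> = (\<Sum>j | (j, i) \<in> E. \<gamma> $ j)" by (simp add: sum.If_cases)
  finally show ?thesis .
qed

text \<open>Summing the pointwise bound gives twice the selected mass minus the mass of all edges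
  entering the neighbours of \<open>T\<close>. The selected mass is at least
  \<open>(1 - \<epsilon>) * d\<close> times the mass of \<open>T\<close>. Edges from
  \<open>T\<close> carry exactly \<open>d\<close> times that mass, and edges from outside at most
  \<open>2 * \<epsilon> * d\<close> times the total mass.\<close>

lemma expander_l1_lower_bound:
  fixes E :: "('p::finite \<times> 'n::finite) set" and \<gamma> :: "real ^ 'p"
  assumes exp: "unbalanced_expander (2 * s) \<epsilon> d E"
    and T: "card T \<le> s" "T \<noteq> {}"
    and top: "\<And>i j. i \<notin> T \<Longrightarrow> j \<in> T \<Longrightarrow> \<bar>\<gamma> $ i\<bar> \<le> \<bar>\<gamma> $ j\<bar>"
  shows "d * ((1 - 2 * \<epsilon>) * (\<Sum>j\<in>T. \<bar>\<gamma> $ j\<bar>) - 2 * \<epsilon> * (\<Sum>j\<in>UNIV. \<bar>\<gamma> $ j\<bar>))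
           \<le> (\<Sum>i\<in>neighbours E T. \<bar>(adjacency_matrix E *v \<gamma>) $ i\<bar>)"
proof -
  let ?N = "neighbours E"
  define x where "x j = \<bar>\<gamma> $ j\<bar>" for j
  have x0: "0 \<le> x j" for j by (simp add: x_def)
  have deg: "card (?N {j}) = d" for j using exp by (simp add: unbalanced_expander_def)
  have "\<exists>j. j \<in> T \<and> (j, i) \<in> E \<and> (\<forall>j'\<in>T. (j', i) \<in> E \<longrightarrow> x j' \<le> x j)" if "i \<in> ?N T" for i
  proof -
    define M where "M = {j \<in> T. (j, i) \<in> E}"
    have M: "finite M" "M \<noteq> {}" using that by (auto simp: M_def neighbours_def)
    then have "Max (x ` M) \<in> x ` M" by (intro Max_in) auto
    then obtain j where "j \<in> M" "x j = Max (x ` M)" by auto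
    then show ?thesis using M by (intro exI[of _ j]) (auto simp: M_def)
  qed
  then obtain f where f: "\<And>i. i \<in> ?N T \<Longrightarrow> f i \<in> T" "\<And>i. i \<in> ?N T \<Longrightarrow> (f i, i) \<in> E"
      "\<And>i j. i \<in> ?N T \<Longrightarrow> j \<in> T \<Longrightarrow> (j, i) \<in> E \<Longrightarrow> x j \<le> x (f i)"
    by metis
  \<comment> \<open>\<open>a j\<close> counts the right vertices that select \<open>j\<close>, and
    \<open>e j\<close> the edges from \<open>j\<close> into the neighbours of
    \<open>T\<close>.\<close>
  define a where "a j = card {i \<in> ?N T. f i = j}" for j
  define e where "e j = card (?N {j} \<inter> ?N T)" for j

  have pointwise: "2 * x (f i) - (\<Sum>j | (j, i) \<in> E. x j) \<le> \<bar>(adjacency_matrix E *v \<gamma>) $ i\<bar>"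
    if i: "i \<in> ?N T" for i
  proof -
    let ?A = "{j. (j, i) \<in> E}"
    have fi: "f i \<in> ?A" using f[OF i] by simp
    have "\<bar>\<Sum>j\<in>?A - {f i}. \<gamma> $ j\<bar> \<le> (\<Sum>j\<in>?A - {f i}. x j)"
      unfolding x_def by (rule sum_abs)
    moreover have "(\<Sum>j\<in>?A. \<gamma> $ j) = \<gamma> $ f i + (\<Sum>j\<in>?A - {f i}. \<gamma> $ j)"
      using fi by (simp add: sum.remove)
    moreover have "sum x ?A = x (f i) + (\<Sum>j\<in>?A - {f i}. x j)"
      using fi by (simp add: sum.remove)
    ultimately show ?thesis unfolding adjacency_mult_nth x_def by linarith
  qed

  have sum_f: "(\<Sum>i\<in>?N T. x (f i)) = (\<Sum>j\<in>T. a j * x j)"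
  proof -
    have "(\<Sum>j\<in>T. a j * x j) = (\<Sum>j\<in>T. \<Sum>i | i \<in> ?N T \<and> f i = j. x (f i))"
      by (simp add: a_def)
    also have "\<dots> = (\<Sum>i\<in>?N T. x (f i))" by (rule sum.group) (auto simp: f)
    finally show ?thesis by simp
  qed
  have sum_e: "(\<Sum>i\<in>?N T. \<Sum>j | (j, i) \<in> E. x j) = (\<Sum>j\<in>UNIV. e j * x j)"
  proof -
    have "(\<Sum>i\<in>?N T. \<Sum>j | (j, i) \<in> E. x j) = (\<Sum>i\<in>?N T. \<Sum>j | j \<in> UNIV \<and> (j, i) \<in> E. x j)"
      by simp
    also have "\<dots> = (\<Sum>j\<in>UNIV. \<Sum>i | i \<in> ?N T \<and> (j, i) \<in> E. x j)"
      by (rule sum.swap_restrict) auto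
    also have "\<dots> = (\<Sum>j\<in>UNIV. e j * x j)"
    proof (intro sum.cong refl)
      fix j
      have "{i. i \<in> ?N T \<and> (j, i) \<in> E} = ?N {j} \<inter> ?N T" by (auto simp: neighbours_def)
      then show "(\<Sum>i | i \<in> ?N T \<and> (j, i) \<in> E. x j) = e j * x j" by (simp add: e_def)
    qed
    finally show ?thesis .
  qed
  have e_T: "e j = d" if "j \<in> T" for j
  proof -
    have "?N {j} \<inter> ?N T = ?N {j}" using that by (auto simp: neighbours_def)
    then show ?thesis by (simp add: e_def deg)
  qed

  \<comment> \<open>If \<open>i\<close> has a neighbour in a superlevel set \<open>U\<close> of
    \<open>T\<close>, the selected vertex \<open>f i\<close> is at least as heavy and so lies in
    \<open>U\<close> too. Hence the fibres of \<open>f\<close> over \<open>U\<close> make up the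
    neighbours of \<open>U\<close>, and expansion bounds the sum of \<open>a\<close> over
    \<open>U\<close> from below.\<close>
  have "0 \<le> (\<Sum>j\<in>T. (a j - (1 - \<epsilon>) * d) * x j)"
  proof (rule sum_mult_nonneg_if_superlevel_sums_nonneg)
    fix t :: real
    define U where "U = {j. j \<in> T \<and> t \<le> x j}"
    have "card U \<le> card T" by (intro card_mono) (auto simp: U_def)
    then have "(1 - \<epsilon>) * d * card U \<le> card (?N U)"
      using exp T by (simp add: unbalanced_expander_def)
    also have "?N U = (\<Union>j\<in>U. {i \<in> ?N T. f i = j})"
    proof
      show "?N U \<subseteq> (\<Union>j\<in>U. {i \<in> ?N T. f i = j})"
      proof
        fix i assume "i \<in> ?N U"
        then obtain j where j: "j \<in> T" "t \<le> x j" "(j, i) \<in> E"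
          by (auto simp: neighbours_def U_def)
        then have i: "i \<in> ?N T" by (auto simp: neighbours_def)
        have "t \<le> x (f i)" using f(3)[OF i j(1,3)] j by simp
        then show "i \<in> (\<Union>j\<in>U. {i \<in> ?N T. f i = j})" using f(1)[OF i] i by (auto simp: U_def)
      qed
    qed (use f(2) in \<open>force simp: neighbours_def[of E U]\<close>)
    also have "card \<dots> = (\<Sum>j\<in>U. a j)"
      unfolding a_def by (rule card_UN_disjoint) auto
    finally show "0 \<le> (\<Sum>j | j \<in> T \<and> t \<le> x j. real (a j) - (1 - \<epsilon>) * d)"
      unfolding U_def[symmetric] by (simp add: sum_subtractf mult_ac)
  qed (auto simp: x0)
  then have lower_a: "(1 - \<epsilon>) * d * sum x T \<le> (\<Sum>j\<in>T. a j * x j)"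
    by (simp add: left_diff_distrib sum_subtractf sum_distrib_left)

  \<comment> \<open>A superlevel set inside \<open>T\<close> contributes no edges, as those from
    \<open>T\<close> are counted separately. Any other contains \<open>T\<close> by
    \<open>top\<close>, and \<open>card T + card (U - T) = card U\<close> turns the block bound into
    \<open>2 * \<epsilon> * d * card U\<close>.\<close>
  have "0 \<le> (\<Sum>j\<in>UNIV. (2 * \<epsilon> * d - (if j \<in> T then 0 else e j)) * x j)"
  proof (rule sum_mult_nonneg_if_superlevel_sums_nonneg)
    fix t :: real
    define U where "U = {j. j \<in> UNIV \<and> t \<le> x j}"
    have "(\<Sum>j\<in>U. real (if j \<in> T then 0 else e j)) = (\<Sum>j\<in>U - T. real (e j))"
      by (intro sum.mono_neutral_cong_right) auto
    also have "\<dots> \<le> 2 * \<epsilon> * d * card U"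
    proof (cases "U \<subseteq> T")
      case True
      then have "U - T = {}" by auto
      moreover have "\<epsilon> > 0" using exp by (simp add: unbalanced_expander_def)
      ultimately show ?thesis by (simp only: sum.empty) simp
    next
      case False
      then obtain j where j: "t \<le> x j" "j \<notin> T" by (auto simp: U_def)
      then have "T \<subseteq> U" using top by (force simp: U_def x_def)
      then have "card T + card (U - T) = card U"
        by (simp add: card_Diff_subset card_mono)
      then show ?thesis
        using expander_common_neighbours_le_blocks[OF exp _ T, of "U - T"]
        unfolding e_def by (metis Diff_disjoint)
    qed
    finally show "0 \<le> (\<Sum>j | j \<in> UNIV \<and> t \<le> x j. 2 * \<epsilon> * d - real (if j \<in> T then 0 else e j))"
      unfolding U_def[symmetric] by (simp only: sum_subtractf sum_constant) (simp add: mult_ac)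
  qed (auto simp: x0)
  then have "(\<Sum>j\<in>UNIV. real (if j \<in> T then 0 else e j) * x j) \<le> 2 * \<epsilon> * d * sum x UNIV"
    by (simp only: left_diff_distrib sum_subtractf sum_distrib_left)
  moreover have "(\<Sum>j\<in>UNIV. e j * x j)
      = (\<Sum>j\<in>UNIV. real (if j \<in> T then 0 else e j) * x j) + d * sum x T"
  proof -
    have "(\<Sum>j\<in>UNIV. e j * x j)
        = (\<Sum>j\<in>UNIV. real (if j \<in> T then 0 else e j) * x j + (if j \<in> T then d * x j else 0))"
      by (intro sum.cong) (auto simp: e_T)
    then show ?thesis by (simp add: sum.distrib sum_distrib_left sum.If_cases)
  qed
  ultimately have upper_e: "(\<Sum>j\<in>UNIV. e j * x j) \<le> 2 * \<epsilon> * d * sum x UNIV + d * sum x T"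
    by simp

  have "d * ((1 - 2 * \<epsilon>) * sum x T - 2 * \<epsilon> * sum x UNIV)
      = 2 * ((1 - \<epsilon>) * d * sum x T) - (2 * \<epsilon> * d * sum x UNIV + d * sum x T)"
    by (simp add: algebra_simps)
  also have "\<dots> \<le> 2 * (\<Sum>j\<in>T. a j * x j) - (\<Sum>j\<in>UNIV. e j * x j)"
    using lower_a upper_e by simp
  also have "\<dots> = (\<Sum>i\<in>?N T. 2 * x (f i) - (\<Sum>j | (j, i) \<in> E. x j))"
    by (simp add: sum_subtractf sum_f sum_e flip: sum_distrib_left)
  also have "\<dots> \<le> (\<Sum>i\<in>?N T. \<bar>(adjacency_matrix E *v \<gamma>) $ i\<bar>)"
    by (intro sum_mono pointwise)
  finally show ?thesis by (simp add: x_def)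
qed

section \<open>Passage to the Euclidean norm and the eigenvalue bound\<close>

lemma sum_abs_le_sqrt_card_norm:
  fixes y :: "real ^ 'n::finite"
  shows "(\<Sum>i\<in>A. \<bar>y $ i\<bar>) \<le> sqrt (card A) * norm y"
proof -
  have "(\<Sum>i\<in>A. \<bar>y $ i\<bar>) \<le> L2_set (\<lambda>_. 1) A * L2_set (\<lambda>i. y $ i) A"
    using L2_set_mult_ineq[of "\<lambda>_. 1" "\<lambda>i. y $ i" A] by simp
  also have "L2_set (\<lambda>_. 1::real) A = sqrt (card A)" by (simp add: L2_set_def)
  also have "L2_set (\<lambda>i. y $ i) A \<le> norm y"
    unfolding norm_vec_def L2_set_def by (simp add: sum_mono2)
  finally show ?thesis by (simp add: mult_left_mono)
qed

lemma l1_norm_restrict_vec: "l1_norm (restrict_vec \<gamma> S) = (\<Sum>j\<in>S. \<bar>\<gamma> $ j\<bar>)"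
  unfolding l1_norm_def restrict_vec_def
  by (rule sum.mono_neutral_cong_right) auto

text \<open>Passing from \<open>S\<close> to the heaviest set \<open>T\<close> of the same size
  increases the mass inside and decreases the mass outside, so the cone condition persists, and a
  lower bound by a positive multiple of \<open>m T\<close> is also one for
  \<open>m S\<close>.\<close>

lemma expander_restricted_l1_bound:
  fixes E :: "('p::finite \<times> 'n::finite) set" and \<gamma> :: "real ^ 'p"
  assumes exp: "unbalanced_expander (2 * s) \<epsilon> d E" and \<epsilon>: "\<epsilon> \<le> 1 / 12" and d: "d \<ge> 1"
    and S: "card S \<le> s" and c0: "c0 < 4" and "\<gamma> \<noteq> 0"
    and cone: "l1_norm (restrict_vec \<gamma> (- S)) \<le> c0 * l1_norm (restrict_vec \<gamma> S)"
  shows "(4 - c0) / 6 \<le> sqrt (card S) * norm (((1 / sqrt d) *\<^sub>R adjacency_matrix E) *v \<gamma>)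
           / l1_norm (restrict_vec \<gamma> S)"
proof -
  define m where "m A = (\<Sum>j\<in>A. \<bar>\<gamma> $ j\<bar>)" for A
  have cone: "m (- S) \<le> c0 * m S" using cone by (simp add: l1_norm_restrict_vec m_def)
  have m0: "0 \<le> m A" for A by (simp add: m_def sum_nonneg)
  have split: "m UNIV = m A + m (- A)" for A
    unfolding m_def Compl_eq_Diff_UNIV by (subst sum.subset_diff[of A]) auto
  have mS: "m S > 0"
  proof (rule ccontr)
    assume "\<not> m S > 0"
    then have "m S = 0" using m0[of S] by simp
    then have "m UNIV = 0" using split[of S] cone m0[of "- S"] by simp
    then have "\<gamma> = 0" by (simp add: m_def sum_nonneg_eq_0_iff vec_eq_iff)
    with \<open>\<gamma> \<noteq> 0\<close> show False by simp
  qed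
  obtain T where T: "card T = card S" "m S \<le> m T"
    and top: "\<And>i j. i \<notin> T \<Longrightarrow> j \<in> T \<Longrightarrow> \<bar>\<gamma> $ i\<bar> \<le> \<bar>\<gamma> $ j\<bar>"
    unfolding m_def by (rule obtain_max_sum_set[of S "\<lambda>j. \<bar>\<gamma> $ j\<bar>"]) blast
  have "T \<noteq> {}" using T(2) mS by (auto simp: m_def)
  define y where "y = adjacency_matrix E *v \<gamma>"
  \<comment> \<open>The cone condition with \<open>m S > 0\<close> excludes negative
    \<open>c0\<close>; the sign allows \<open>m S\<close> to be replaced by \<open>m T\<close> on
    the right of the cone condition.\<close>
  have "0 \<le> c0"
    using cone m0[of "- S"] mS by (metis not_le mult_neg_pos order_trans)
  have "m (- T) \<le> m (- S)" using split[of S] split[of T] T(2) by simp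
  also have "\<dots> \<le> c0 * m S" by (rule cone)
  also have "\<dots> \<le> c0 * m T" using T(2) \<open>0 \<le> c0\<close> by (rule mult_left_mono)
  finally have mU: "m UNIV \<le> (1 + c0) * m T" using split[of T] by (simp add: algebra_simps)

  \<comment> \<open>At \<open>\<epsilon> = 1 / 12\<close> and \<open>m UNIV = (1 + c0) * m T\<close>
    the coefficient of \<open>m T\<close> is
    \<open>1 - 1/6 - (1 + c0)/6 = (4 - c0) / 6\<close>.\<close>
  have "\<epsilon> * (m T + m UNIV) \<le> 1 / 12 * (m T + m UNIV)"
    using \<epsilon> m0 by (intro mult_right_mono) (auto intro: add_nonneg_nonneg)
  then have "(4 - c0) / 6 * m T \<le> (1 - 2 * \<epsilon>) * m T - 2 * \<epsilon> * m UNIV"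
    using mU unfolding left_diff_distrib distrib_left distrib_right
    by (simp add: diff_divide_distrib left_diff_distrib)
  moreover have "(4 - c0) / 6 * m S \<le> (4 - c0) / 6 * m T"
    using T(2) c0 by (intro mult_left_mono) auto
  ultimately have "d * ((4 - c0) / 6 * m S) \<le> d * ((1 - 2 * \<epsilon>) * m T - 2 * \<epsilon> * m UNIV)"
    by (intro mult_left_mono) auto
  also have "\<dots> \<le> (\<Sum>i\<in>neighbours E T. \<bar>y $ i\<bar>)"
    unfolding m_def y_def
    using expander_l1_lower_bound[OF exp _ \<open>T \<noteq> {}\<close> top] S T(1) by simp
  also have "\<dots> \<le> sqrt (card (neighbours E T)) * norm y"
    by (rule sum_abs_le_sqrt_card_norm)
  \<comment> \<open>The factor \<open>sqrt d\<close> obtained here equals \<open>d / sqrt d\<close>: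
    the normalisation of the matrix absorbs \<open>1 / sqrt d\<close>, and \<open>d\<close> cancels
    against the left side.\<close>
  also have "\<dots> \<le> sqrt (d * card S) * norm y"
  proof (rule mult_right_mono)
    show "sqrt (card (neighbours E T)) \<le> sqrt (d * card S)"
      using card_neighbours_le[OF exp, of T] T(1)
      by (metis of_nat_mono of_nat_mult real_sqrt_le_iff)
  qed simp
  also have "\<dots> = d * (sqrt (card S) * (1 / sqrt d * norm y))"
    using d by (simp add: real_sqrt_mult field_simps)
  finally have "(4 - c0) / 6 * m S \<le> sqrt (card S) * (1 / sqrt d * norm y)"
    using d by (subst (asm) mult_le_cancel_left_pos) auto
  moreover have "norm (((1 / sqrt d) *\<^sub>R adjacency_matrix E) *v \<gamma>) = 1 / sqrt d * norm y"
    by (simp add: y_def scaleR_matrix_vector_assoc[symmetric])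
  ultimately show ?thesis
    using mS by (simp only: l1_norm_restrict_vec pos_le_divide_eq flip: m_def)
qed

theorem proposition4p1:
  fixes E :: "('p::finite \<times> 'n::finite) set"
    and \<Phi> X :: "real ^ 'p ^ 'n"
    and s d :: nat
    and \<epsilon> :: real
  assumes "unbalanced_expander (2 * s) \<epsilon> d E"
    and "\<epsilon> \<le> 1 / 12"
    and "d \<ge> 1"
    and "\<Phi> = adjacency_matrix E"
    and "X = (1 / sqrt (real d)) *\<^sub>R \<Phi>"
    and "1 / \<epsilon> < real CARD('p)"
    and "d < CARD('p)"
  shows "\<forall>c0 < 4.
           (\<forall>S. card S \<le> s \<longrightarrow>
              (\<forall>\<gamma>. \<gamma> \<noteq> 0 \<longrightarrow>
                 l1_norm (restrict_vec \<gamma> (- S)) \<le> c0 * l1_norm (restrict_vec \<gamma> S) \<longrightarrow>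
                 sqrt (real (card S)) * norm (X *v \<gamma>) / l1_norm (restrict_vec \<gamma> S)
                   \<ge> (4 - c0) / 6)) \<and>
           restricted_l1_eigenvalue X s c0 \<ge> ereal ((4 - c0) / 6)"
proof (intro allI impI conjI)
  fix c0 :: real and S \<gamma>
  assume "c0 < 4" "card S \<le> s" "\<gamma> \<noteq> (0 :: real ^ 'p)"
    "l1_norm (restrict_vec \<gamma> (- S)) \<le> c0 * l1_norm (restrict_vec \<gamma> S)"
  then show "(4 - c0) / 6
      \<le> sqrt (real (card S)) * norm (X *v \<gamma>) / l1_norm (restrict_vec \<gamma> S)"
    unfolding assms(4,5) by (intro expander_restricted_l1_bound[OF assms(1-3)])
next
  fix c0 :: real
  assume c0: "c0 < 4"
  \<comment> \<open>The bound holds for every admissible pair and so passes to both infima; an empty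
    family gives \<open>\<infinity>\<close>, which satisfies it as well.\<close>
  show "ereal ((4 - c0) / 6) \<le> restricted_l1_eigenvalue X s c0"
    unfolding restricted_l1_eigenvalue_def assms(4,5)
    using expander_restricted_l1_bound[OF assms(1-3) _ c0]
    by (intro INF_greatest) (auto simp: mem_Collect_eq)
qed

end
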